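(* Let $\mathcal{A}$ and $\mathcal{B}$ be two factorial designs of the design space $\mathcal{D}$, and let $\{C_{\mathbf{t}}(\mathbf{x}),\mathbf{t}\in\mathcal{T}\}$ be an orthogonal polynomial basis (OPB) defined on $\mathcal{D}$. Let $F_{\mathcal{A}}(\mathbf{x})=\sum_{\mathbf{t}\in\mathcal{T}} b_{\mathbf{t}}C_{\mathbf{t}}(\mathbf{x})$ and $F_{\mathcal{B}}(\mathbf{x})=\sum_{\mathbf{t}\in\mathcal{T}} b'_{\mathbf{t}}C_{\mathbf{t}}(\mathbf{x})$ be the indicator functions of $\mathcal{A}$ and $\mathcal{B}$, respectively. Then $\mathcal{A}$ and $\mathcal{B}$ are geometrically isomorphic if and only if there exist a permutation $(i_1 i_2\ldots i_k)$ of $(1,2,\ldots,k)$ (with $s_{i_l}=s_l$ for all $l$, so that permuted indices remain in $\mathcal{T}$) and a vector $(j_1 j_2\ldots j_k)$, where each $j_l$ is either $0$ or $1$, such that $$b_{t_1t_2\ldots t_k} = \left(\prod_{l=1}^k (-1)^{j_l t_l}\right) b'_{t_{i_1}t_{i_2}\ldots t_{i_k}}$$ for all $\mathbf{t}=(t_1 t_2\ldots t_k)\in\mathcal{T}$.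
   Context: Let $k\ge 1$, let $s_1,\ldots,s_k$ be positive integers, and let $G_i=\{0,1,\ldots,s_i-1\}\subset\mathbb{R}$ be the set of levels of the $i$th factor. The design space is $\mathcal{D}=G_1\times\cdots\times G_k\subset\mathbb{R}^k$ (the full factorial design, with $N=s_1\cdots s_k$ points); the index set is $\mathcal{T}=G_1\times\cdots\times G_k$. A factorial design in $\mathcal{D}$ is a finite collection of points of $\mathcal{D}$, in which a point may appear more than once. The indicator function $F_{\mathcal{A}}$ of a design $\mathcal{A}$ is the function on $\mathcal{D}$ whose value at $\mathbf{x}$ is the number of appearances of $\mathbf{x}$ in $\mathcal{A}$. For each factor $i$, let $C^i_0,\ldots,C^i_{s_i-1}$ be functions on $G_i$ with $\sum_{x\in G_i} C^i_u(x)C^i_v(x) = 0$ if $u\ne v$ and $=s_i$ if $u=v$, such that $C^i_0\equiv 1$ and $C^i_j$ is a polynomial of degree $j$ for each $j=0,1,\ldots,s_i-1$. The family $C_{\mathbf{t}}(\mathbf{x})=\prod_{i=1}^k C^i_{t_i}(x_i)$, $\mathbf{t}=(t_1,\ldots,t_k)\in\mathcal{T}$, is called an orthogonal polynomial basis (OPB) on $\mathcal{D}$. It is a basis of the real functions on $\mathcal{D}$, so the coefficients in the expansion of an indicator function are uniquely determined. Two designs $\mathcal{A},\mathcal{B}$ from the same design space $\mathcal{D}$ are geometrically isomorphic if one can be obtained from the other by variable exchange (permuting the factors, i.e. the coordinates, in such a way that the resulting design is still in $\mathcal{D}$) and/or reversing the level order of one or more factors (replacing $x_i$ by $s_i-1-x_i$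 in all points of the design).
   Formalization: Factors with equally many levels are assumed to use the same polynomials C^i_u; with signs chosen freely per factor the claim fails (s=(3,3), C^1_2=-C^2_2). Variable exchange is read as mapping the whole design space into itself. *)

theory Defs
  imports "HOL-Analysis.Analysis" "HOL-Library.Multiset"
begin

text \<open>The factors are indexed by a finite type \<open>'k\<close>, so that \<open>k = CARD('k) \<ge> 1\<close>;
  factor \<open>i\<close> has \<open>s i\<close> levels. A design is a finite multiset of points.\<close>

definition levels :: "nat \<Rightarrow> real set" where
  "levels n = real ` {..<n}"

definition design_space :: "('k::finite \<Rightarrow> nat) \<Rightarrow> (real ^ 'k) set" where
  "design_space s = {x. \<forall>i. x $ i \<in> levels (s i)}"

text \<open>The index set is the same product of level sets, with its entries read as natural numbers,
  since they serve as polynomial degrees and exponents.\<close>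

definition index_set :: "('k::finite \<Rightarrow> nat) \<Rightarrow> ('k \<Rightarrow> nat) set" where
  "index_set s = {t. \<forall>i. t i < s i}"

definition is_design :: "('k::finite \<Rightarrow> nat) \<Rightarrow> (real ^ 'k) multiset \<Rightarrow> bool" where
  "is_design s A \<longleftrightarrow> set_mset A \<subseteq> design_space s"

definition indicator_fun :: "(real ^ 'k) multiset \<Rightarrow> real ^ 'k::finite \<Rightarrow> real" where
  "indicator_fun A x = real (count A x)"

text \<open>\<open>C i u\<close> is the \<open>u\<close>-th basis function of factor \<open>i\<close>. Only its values on the levels of
  factor \<open>i\<close>, and only for \<open>u < s i\<close>, matter.\<close>

definition is_OPB :: "('k::finite \<Rightarrow> nat) \<Rightarrow> ('k \<Rightarrow> nat \<Rightarrow> real \<Rightarrow> real) \<Rightarrow> bool" where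
  "is_OPB s C \<longleftrightarrow> (\<forall>i.
     (\<forall>u<s i. \<forall>v<s i. (\<Sum>x\<in>levels (s i). C i u x * C i v x) = (if u = v then real (s i) else 0)) \<and>
     (\<forall>x\<in>levels (s i). C i 0 x = 1) \<and>
     (\<forall>u<s i. \<exists>p :: real poly. degree p = u \<and> (\<forall>x\<in>levels (s i). C i u x = poly p x)))"

definition OPB_fun :: "('k::finite \<Rightarrow> nat \<Rightarrow> real \<Rightarrow> real) \<Rightarrow> ('k \<Rightarrow> nat) \<Rightarrow> real ^ 'k \<Rightarrow> real" where
  "OPB_fun C t x = (\<Prod>i\<in>UNIV. C i (t i) (x $ i))"

definition permute_factors :: "('k \<Rightarrow> 'k) \<Rightarrow> real ^ 'k \<Rightarrow> real ^ 'k::finite" where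
  "permute_factors \<pi> x = (\<chi> l. x $ \<pi> l)"

definition reverse_factor :: "('k::finite \<Rightarrow> nat) \<Rightarrow> 'k \<Rightarrow> real ^ 'k \<Rightarrow> real ^ 'k" where
  "reverse_factor s i x = (\<chi> l. if l = i then real (s i) - 1 - x $ i else x $ l)"

text \<open>A variable exchange has to respect the whole design space. It would not be enough to ask that
  the points of the particular design stay inside: with 2 and 3 levels, exchanging the two factors
  of the one-point design \<open>(1, 0)\<close> gives the point \<open>(0, 1)\<close>, which lies in the design space, but
  there the level 1 of the second factor is the middle one.\<close>

inductive obtainable :: "('k::finite \<Rightarrow> nat) \<Rightarrow> (real ^ 'k) multiset \<Rightarrow> (real ^ 'k) multiset \<Rightarrow> bool"
  for s :: "'k::finite \<Rightarrow> nat" and A :: "(real ^ 'k) multiset" where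
  refl: "obtainable s A A"
| exchange: "obtainable s A B \<Longrightarrow> \<pi> permutes UNIV \<Longrightarrow>
    permute_factors \<pi> ` design_space s \<subseteq> design_space s \<Longrightarrow>
    obtainable s A (image_mset (permute_factors \<pi>) B)"
| reverse: "obtainable s A B \<Longrightarrow> obtainable s A (image_mset (reverse_factor s i) B)"

definition geometrically_isomorphic ::
    "('k::finite \<Rightarrow> nat) \<Rightarrow> (real ^ 'k) multiset \<Rightarrow> (real ^ 'k) multiset \<Rightarrow> bool" where
  "geometrically_isomorphic s A B \<longleftrightarrow> obtainable s A B \<or> obtainable s B A"

end

theory Submission imports Defs begin

text \<open>Up to composition, the isomorphisms are the signed permutations: a permutation of the factors
  that preserves the level numbers, followed by reversals of some factors. The polynomial \<open>C i u\<close> is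
  orthogonal to all polynomials of lower degree, and so is its reflection in the centre of the
  levels, which has the leading coefficient multiplied by \<open>(-1) ^ u\<close>. Hence the reflection equals
  \<open>(-1) ^ u * C i u\<close>, and a signed permutation acts on the basis, and thereby on the coefficients
  of an indicator function, by permuting the index and multiplying by a sign.\<close>

section \<open>Reversal of the levels of one factor\<close>

text \<open>The Boolean covers reversal and identity by one formula, so that a predicate on the
  factors records which of them are reversed.\<close>

definition flip :: "bool \<Rightarrow> nat \<Rightarrow> real \<Rightarrow> real" where
  "flip r n x = (if r then real n - 1 - x else x)"

lemma flip_flip: "flip q n (flip r n x) = flip (q \<noteq> r) n x"
  by (auto simp: flip_def)

lemma flip_False [simp]: "flip False n x = x"
  by (simp add: flip_def)

lemma flip_in_levels: "x \<in> levels n \<Longrightarrow> flip r n x \<in> levels n"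
proof -
  assume "x \<in> levels n"
  then obtain m where m: "m < n" "x = real m" by (auto simp: levels_def)
  then have "real n - 1 - x = real (n - 1 - m)" by auto
  moreover have "n - 1 - m < n" using m by auto
  ultimately show ?thesis using \<open>x \<in> levels n\<close> unfolding flip_def levels_def by auto
qed

lemma flip_in_levels_iff: "flip r n x \<in> levels n \<longleftrightarrow> x \<in> levels n"
  using flip_in_levels[of x n r] flip_in_levels[of "flip r n x" n r] by (auto simp: flip_flip)

lemma finite_levels [simp]: "finite (levels n)"
  by (simp add: levels_def)

lemma sum_levels_flip: "(\<Sum>x\<in>levels n. f (flip r n x)) = (\<Sum>x\<in>levels n. f x)"
  by (rule sum.reindex_bij_witness[where i = "flip r n" and j = "flip r n"])
     (auto simp: flip_flip flip_in_levels)

section \<open>Orthogonal polynomials of one factor and their symmetry\<close>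

lemma OPB_orth:
  "is_OPB s C \<Longrightarrow> u < s i \<Longrightarrow> v < s i \<Longrightarrow>
    (\<Sum>x\<in>levels (s i). C i u x * C i v x) = (if u = v then real (s i) else 0)"
  by (simp add: is_OPB_def)

lemma OPB_poly:
  assumes "is_OPB s C" "u < s i"
  obtains p where "degree p = u" "p \<noteq> 0" "\<And>x. x \<in> levels (s i) \<Longrightarrow> C i u x = poly p x"
proof -
  obtain p where p: "degree p = u" "\<And>x. x \<in> levels (s i) \<Longrightarrow> C i u x = poly p x"
    using assms unfolding is_OPB_def by blast
  \<comment> \<open>As \<open>degree 0 = 0\<close>, the degree condition admits the zero polynomial
    when \<open>u = 0\<close>; the positive squared norm \<open>s i\<close> of \<open>C i u\<close>
    excludes it.\<close>
  have "p \<noteq> 0"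
    using OPB_orth[OF assms assms(2)] p(2) assms(2) by auto
  with p that show thesis by blast
qed

text \<open>Induction on the bound: a multiple of the basis polynomial of degree
  \<open>n < u\<close>, itself orthogonal to \<open>C i u\<close>, removes the coefficient of
  \<open>q\<close> at \<open>n\<close>. The bound is put on coefficients rather than on the degree,
  so that \<open>n = 0\<close> means \<open>q = 0\<close>.\<close>

lemma OPB_orth_lower_degree:
  assumes OPB: "is_OPB s C" and u: "u < s i"
    and "n \<le> u" "\<And>m. n \<le> m \<Longrightarrow> coeff q m = 0"
  shows "(\<Sum>x\<in>levels (s i). C i u x * poly q x) = 0"
  using assms(3,4)
proof (induction n arbitrary: q)
  case 0
  then have "q = 0" by (simp add: poly_eq_iff)
  then show ?case by simp
next
  case (Suc n)
  have n: "n < s i" using Suc.prems(1) u by simp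
  obtain p where p: "degree p = n" "p \<noteq> 0" "\<And>x. x \<in> levels (s i) \<Longrightarrow> C i n x = poly p x"
    using OPB_poly[where i = i and u = n, OF OPB n] by blast
  define c where "c = coeff q n / coeff p n"
  have "coeff p n \<noteq> 0" using p by auto
  then have q_low: "coeff (q - smult c p) m = 0" if "n \<le> m" for m
    using that Suc.prems(2)[of m] p(1)
    by (cases "m = n") (auto simp: c_def coeff_eq_0)
  then have "(\<Sum>x\<in>levels (s i). C i u x * poly (q - smult c p) x) = 0"
    using Suc.prems(1) by (intro Suc.IH q_low) simp_all
  moreover have "(\<Sum>x\<in>levels (s i). C i u x * poly p x) = 0"
    using OPB_orth[where i = i, OF OPB u n] p(3) Suc.prems(1) by (simp cong: sum.cong)
  then have "(\<Sum>x\<in>levels (s i). c * (C i u x * poly p x)) = 0"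
    by (simp flip: sum_distrib_left)
  ultimately show ?case
    by (simp add: right_diff_distrib mult.left_commute[of _ c] sum_subtractf)
qed

text \<open>Substituting a linear polynomial keeps the degree and multiplies the leading coefficient
  by a power of the inner one, here \<open>-1\<close>.\<close>

lemma coeff_pcompose_reflect:
  fixes p :: "real poly"
  shows "coeff (pcompose p [:a, -1:]) (degree p) = (-1) ^ degree p * lead_coeff p"
  using lead_coeff_comp[of "[:a, -1:]" p] by (simp add: degree_pcompose mult.commute)

text \<open>On the levels, the polynomial \<open>q\<close> below is the signed reflection of
  \<open>C i u\<close> minus \<open>C i u\<close>. Its degree is too low for it not to be orthogonal
  to both, so it is orthogonal to itself and vanishes at every level.\<close>

lemma OPB_reverse:
  assumes OPB: "is_OPB s C" and u: "u < s i" and x: "x \<in> levels (s i)"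
  shows "C i u (real (s i) - 1 - x) = (-1) ^ u * C i u x"
proof -
  define L where "L = levels (s i)"
  define \<rho> where "\<rho> = flip True (s i)"
  have \<rho>: "\<rho> y = real (s i) - 1 - y" for y by (simp add: \<rho>_def flip_def)
  have \<rho>L: "\<rho> y \<in> L" if "y \<in> L" for y using that by (simp add: \<rho>_def L_def flip_in_levels)
  obtain p where p: "degree p = u" "\<And>y. y \<in> L \<Longrightarrow> C i u y = poly p y"
    using OPB_poly[where i = i, OF OPB u] unfolding L_def by blast
  define R where "R = [:real (s i) - 1, -1:]"
  have R: "poly R y = \<rho> y" for y by (simp add: R_def \<rho>)
  \<comment> \<open>The factor \<open>(-1) ^ u\<close> makes the terms of degree \<open>u\<close>
    cancel.\<close>
  define q where "q = smult ((-1) ^ u) (pcompose p R) - p"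
  have q_low: "coeff q m = 0" if "u \<le> m" for m
  proof (cases "m = u")
    case True
    then show ?thesis
      using coeff_pcompose_reflect[of p "real (s i) - 1"] p(1)
      by (simp add: q_def R_def)
  next
    case False
    then show ?thesis
      using that p(1) by (simp add: q_def coeff_eq_0 R_def degree_pcompose)
  qed
  \<comment> \<open>Reflecting the summation variable moves the reflection from \<open>C i u\<close>
    to \<open>q\<close>, so the bound is needed for the reflected \<open>q\<close> too. The case
    \<open>q = 0\<close> is separate because its degree 0 is not below \<open>u = 0\<close>.\<close>
  have qR_low: "coeff (pcompose q R) m = 0" if "u \<le> m" for m
  proof (cases "q = 0")
    case False
    then have "degree q < u" using q_low leading_coeff_0_iff not_less by blast
    then show ?thesis using that by (simp add: coeff_eq_0 R_def degree_pcompose)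
  qed simp
  have q: "poly q y = (-1) ^ u * C i u (\<rho> y) - C i u y" if "y \<in> L" for y
    using that \<rho>L p(2) by (simp add: q_def poly_pcompose R)
  have Cq: "(\<Sum>y\<in>L. C i u y * poly q y) = 0"
    unfolding L_def by (rule OPB_orth_lower_degree[OF OPB u order_refl q_low])
  have "(\<Sum>y\<in>L. C i u (\<rho> y) * poly q y) = (\<Sum>y\<in>L. C i u (\<rho> (\<rho> y)) * poly q (\<rho> y))"
    unfolding L_def \<rho>_def by (rule sum_levels_flip[symmetric])
  also have "\<dots> = (\<Sum>y\<in>L. C i u y * poly (pcompose q R) y)"
    by (simp add: poly_pcompose R \<rho>)
  also have "\<dots> = 0"
    unfolding L_def by (rule OPB_orth_lower_degree[OF OPB u order_refl qR_low])
  finally have \<rho>q: "(\<Sum>y\<in>L. C i u (\<rho> y) * poly q y) = 0" .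
  have "(\<Sum>y\<in>L. poly q y * poly q y) =
      (\<Sum>y\<in>L. (-1) ^ u * (C i u (\<rho> y) * poly q y) - C i u y * poly q y)"
    by (rule sum.cong) (simp_all add: q algebra_simps)
  also have "\<dots> = 0"
    using Cq \<rho>q by (simp add: sum_subtractf flip: sum_distrib_left)
  finally have "poly q x * poly q x = 0"
    using x by (subst (asm) sum_nonneg_eq_0_iff) (auto simp: L_def)
  then have "(-1) ^ u * C i u (\<rho> x) = C i u x" using q[of x] x by (simp add: L_def)
  \<comment> \<open>The sign is its own inverse and so changes sides.\<close>
  then have "(-1) ^ u * ((-1) ^ u * C i u (\<rho> x)) = (-1) ^ u * C i u x" by simp
  then show ?thesis by (simp add: \<rho>)
qed

lemma OPB_flip:
  assumes "is_OPB s C" "u < s i" "x \<in> levels (s i)"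
  shows "C i u (flip r (s i) x) = (-1) ^ (of_bool r * u) * C i u x"
  using OPB_reverse[where i = i, OF assms] by (simp add: flip_def)

section \<open>Orthogonality and coefficients on the design space\<close>

lemma bij_betw_PiE_design_space:
  "bij_betw (\<lambda>f. \<chi> i. f i) (PiE UNIV (\<lambda>i. levels (s i))) (design_space s)"
  by (rule bij_betw_byWitness[where f' = "\<lambda>x i. x $ i"]) (auto simp: design_space_def PiE_def)

text \<open>Distributivity on the grid; it reduces inner products of basis functions to those of
  single factors.\<close>

lemma sum_prod_design_space:
  fixes f :: "'k::finite \<Rightarrow> real \<Rightarrow> real"
  shows "(\<Sum>x\<in>design_space s. \<Prod>i\<in>UNIV. f i (x $ i)) = (\<Prod>i\<in>UNIV. \<Sum>y\<in>levels (s i). f i y)"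
  using sum.reindex_bij_betw[OF bij_betw_PiE_design_space, of "\<lambda>x. \<Prod>i\<in>UNIV. f i (x $ i)" s]
  by (simp add: prod_sum_PiE)

lemma finite_index_set: "finite (index_set s)"
proof -
  have "index_set s = PiE UNIV (\<lambda>i. {..<s i})" by (auto simp: index_set_def PiE_def)
  then show ?thesis by (simp add: finite_PiE)
qed

lemma OPB_fun_orth:
  assumes "is_OPB s C" "t \<in> index_set s" "t' \<in> index_set s"
  shows "(\<Sum>x\<in>design_space s. OPB_fun C t x * OPB_fun C t' x) =
    (if t = t' then (\<Prod>i\<in>UNIV. real (s i)) else 0)"
proof -
  have "(\<Sum>x\<in>design_space s. OPB_fun C t x * OPB_fun C t' x) =
      (\<Prod>i\<in>UNIV. \<Sum>y\<in>levels (s i). C i (t i) y * C i (t' i) y)"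
    by (simp add: OPB_fun_def flip: prod.distrib sum_prod_design_space)
  \<comment> \<open>One coordinate in which the indices differ already makes the product
    zero.\<close>
  also have "\<dots> = (\<Prod>i\<in>UNIV. if t i = t' i then real (s i) else 0)"
    using assms(2,3) by (intro prod.cong) (simp_all add: OPB_orth[OF assms(1)] index_set_def)
  also have "\<dots> = (if t = t' then (\<Prod>i\<in>UNIV. real (s i)) else 0)"
    by (auto simp: fun_eq_iff intro!: prod_zero)
  finally show ?thesis .
qed

text \<open>Orthogonality leaves only the term at \<open>t\<close>. This is the uniqueness of the
  coefficients, in the form that carries identities between functions over to coefficients.\<close>

lemma OPB_coeff:
  assumes OPB: "is_OPB s C" and t: "t \<in> index_set s"
    and F: "\<And>x. x \<in> design_space s \<Longrightarrow> F x = (\<Sum>t\<in>index_set s. b t * OPB_fun C t x)"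
  shows "(\<Sum>x\<in>design_space s. F x * OPB_fun C t x) = (\<Prod>i\<in>UNIV. real (s i)) * b t"
proof -
  have "(\<Sum>x\<in>design_space s. F x * OPB_fun C t x) =
      (\<Sum>x\<in>design_space s. \<Sum>u\<in>index_set s. b u * (OPB_fun C u x * OPB_fun C t x))"
    by (simp add: F sum_distrib_right mult.assoc)
  also have "\<dots> = (\<Sum>u\<in>index_set s. b u * (\<Sum>x\<in>design_space s. OPB_fun C u x * OPB_fun C t x))"
    by (subst sum.swap) (simp add: sum_distrib_left)
  also have "\<dots> = (\<Sum>u\<in>index_set s. if u = t then b u * (\<Prod>i\<in>UNIV. real (s i)) else 0)"
    by (intro sum.cong) (simp_all add: OPB_fun_orth[OF OPB _ t])
  also have "\<dots> = (\<Prod>i\<in>UNIV. real (s i)) * b t"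
    using t by (simp add: finite_index_set)
  finally show ?thesis .
qed

section \<open>Signed permutations of the design space\<close>

text \<open>Coordinates are permuted first and reversed afterwards, so \<open>r\<close> and the
  number of levels are taken at the new position.\<close>

definition signed_perm ::
    "('k::finite \<Rightarrow> nat) \<Rightarrow> ('k \<Rightarrow> 'k) \<Rightarrow> ('k \<Rightarrow> bool) \<Rightarrow> real ^ 'k \<Rightarrow> real ^ 'k" where
  "signed_perm s \<sigma> r x = (\<chi> l. flip (r l) (s l) (x $ \<sigma> l))"

definition level_perm :: "('k::finite \<Rightarrow> nat) \<Rightarrow> ('k \<Rightarrow> 'k) \<Rightarrow> bool" where
  "level_perm s \<sigma> \<longleftrightarrow> \<sigma> permutes UNIV \<and> (\<forall>l. s (\<sigma> l) = s l)"

lemma level_perm_inv: "level_perm s \<sigma> \<Longrightarrow> level_perm s (inv \<sigma>)"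
  unfolding level_perm_def by (metis permutes_inv permutes_inverses(1))

lemma level_perm_levels: "level_perm s \<sigma> \<Longrightarrow> s (\<sigma> l) = s l"
  by (simp add: level_perm_def)

lemma level_perm_inverses:
  assumes "level_perm s \<sigma>"
  shows "\<sigma> (inv \<sigma> l) = l" "inv \<sigma> (\<sigma> l) = l"
  using assms permutes_inverses[of \<sigma> UNIV] by (simp_all add: level_perm_def)

lemma level_perm_inv_inv: "level_perm s \<sigma> \<Longrightarrow> inv (inv \<sigma>) = \<sigma>"
  using permutes_inv_inv[of \<sigma> UNIV] by (simp add: level_perm_def)

lemma level_perm_index_set:
  "level_perm s \<sigma> \<Longrightarrow> t \<in> index_set s \<Longrightarrow> (\<lambda>l. t (\<sigma> l)) \<in> index_set s"
  unfolding level_perm_def index_set_def by (auto, metis)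

text \<open>The reversal at \<open>inv \<sigma> l\<close> ends up at coordinate \<open>l\<close>,
  and must be undone there; this dictates the second argument of the inverse.\<close>

lemma signed_perm_inv1:
  assumes "level_perm s \<sigma>"
  shows "signed_perm s (inv \<sigma>) (\<lambda>l. r (inv \<sigma> l)) (signed_perm s \<sigma> r x) = x"
  using assms level_perm_inv[OF assms]
  by (simp add: vec_eq_iff signed_perm_def flip_flip level_perm_inverses level_perm_levels)

lemma signed_perm_inv2:
  assumes "level_perm s \<sigma>"
  shows "signed_perm s \<sigma> r (signed_perm s (inv \<sigma>) (\<lambda>l. r (inv \<sigma> l)) x) = x"
  using assms
  by (simp add: vec_eq_iff signed_perm_def flip_flip level_perm_inverses level_perm_levels)

lemma bij_signed_perm: "level_perm s \<sigma> \<Longrightarrow> bij (signed_perm s \<sigma> r)"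
  by (rule o_bij[where g = "signed_perm s (inv \<sigma>) (\<lambda>l. r (inv \<sigma> l))"])
     (simp_all add: fun_eq_iff signed_perm_inv1 signed_perm_inv2)

lemma signed_perm_in_design_space_iff:
  assumes "level_perm s \<sigma>"
  shows "signed_perm s \<sigma> r x \<in> design_space s \<longleftrightarrow> x \<in> design_space s"
proof -
  have "\<sigma> permutes UNIV" and s: "\<And>l. s (\<sigma> l) = s l" using assms by (auto simp: level_perm_def)
  have "signed_perm s \<sigma> r x \<in> design_space s \<longleftrightarrow> (\<forall>l. x $ \<sigma> l \<in> levels (s (\<sigma> l)))"
    by (simp add: design_space_def signed_perm_def flip_in_levels_iff s)
  also have "\<dots> \<longleftrightarrow> x \<in> design_space s"
    unfolding design_space_def using permutes_inverses(1)[OF \<open>\<sigma> permutes UNIV\<close>]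
    by (auto, metis)
  finally show ?thesis .
qed

section \<open>Geometric isomorphisms as signed permutations\<close>

text \<open>The image of the top corner shows \<open>s (\<pi> l) \<le> s l\<close> for each
  \<open>l\<close>. Both sides have the same sum over all factors, so no inequality is
  strict.\<close>

lemma level_perm_if_design_space_invariant:
  assumes pos: "\<And>i. 0 < s i" and \<pi>: "\<pi> permutes UNIV"
    and sub: "permute_factors \<pi> ` design_space s \<subseteq> design_space s"
  shows "level_perm s \<pi>"
proof -
  \<comment> \<open>The subtraction is on natural numbers; as \<open>s i\<close> is positive,
    \<open>s i - 1\<close> is the highest level.\<close>
  define x :: "real ^ 'a" where "x = (\<chi> i. real (s i - 1))"
  have "x \<in> design_space s"
    using pos by (auto simp: x_def design_space_def levels_def)
  then have "permute_factors \<pi> x \<in> design_space s" using sub by blast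
  then have "s (\<pi> l) - 1 < s l" for l
    by (auto simp: permute_factors_def x_def design_space_def levels_def)
  then have le: "s (\<pi> l) \<le> s l" for l
    using pos[of "\<pi> l"] by (metis Suc_leI Suc_pred' diff_Suc_1)
  have "(\<Sum>l\<in>UNIV. s (\<pi> l)) = (\<Sum>l\<in>UNIV. s l)"
    using sum.permute[OF \<pi>, of s] by (simp add: o_def)
  then have "\<not> s (\<pi> l) < s l" for l
    using sum_strict_mono_ex1[of UNIV "\<lambda>l. s (\<pi> l)" s] le by auto
  then show ?thesis
    using \<pi> le unfolding level_perm_def by (auto simp: le_less)
qed

text \<open>Signed permutations contain the identity and are closed under a further exchange or
  reversal.\<close>

lemma obtainable_imp_signed_perm:
  assumes "obtainable s A B" and pos: "\<And>i. 0 < s i"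
  shows "\<exists>\<sigma> r. level_perm s \<sigma> \<and> B = image_mset (signed_perm s \<sigma> r) A"
  using assms(1)
proof induction
  case refl
  have "signed_perm s id (\<lambda>_. False) = (\<lambda>x. x)"
    by (simp add: fun_eq_iff vec_eq_iff signed_perm_def)
  then have "A = image_mset (signed_perm s id (\<lambda>_. False)) A" by simp
  moreover have "level_perm s id" by (simp add: level_perm_def permutes_id)
  ultimately show ?case by blast
next
  case (exchange B \<pi>)
  then obtain \<sigma> r where \<sigma>: "level_perm s \<sigma>" and B: "B = image_mset (signed_perm s \<sigma> r) A"
    by blast
  have \<pi>: "level_perm s \<pi>"
    using level_perm_if_design_space_invariant[where s = s, OF pos] exchange.hyps by blast
  \<comment> \<open>The left side reverses with \<open>s (\<pi> l)\<close> levels and the right side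
    with \<open>s l\<close>; these agree because \<open>\<pi>\<close> preserves the level
    numbers.\<close>
  have "permute_factors \<pi> \<circ> signed_perm s \<sigma> r = signed_perm s (\<sigma> \<circ> \<pi>) (r \<circ> \<pi>)"
    using \<pi> by (simp add: fun_eq_iff vec_eq_iff signed_perm_def permute_factors_def level_perm_def)
  then have "image_mset (permute_factors \<pi>) B = image_mset (signed_perm s (\<sigma> \<circ> \<pi>) (r \<circ> \<pi>)) A"
    by (simp add: B image_mset.compositionality)
  moreover have "level_perm s (\<sigma> \<circ> \<pi>)"
    using \<pi> \<sigma> by (simp add: level_perm_def permutes_compose)
  ultimately show ?case by blast
next
  case (reverse B i)
  then obtain \<sigma> r where \<sigma>: "level_perm s \<sigma>" and B: "B = image_mset (signed_perm s \<sigma> r) A"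
    by blast
  \<comment> \<open>A second reversal of a factor cancels the first, hence the entry at
    \<open>i\<close> is toggled.\<close>
  have "reverse_factor s i \<circ> signed_perm s \<sigma> r = signed_perm s \<sigma> (r(i := \<not> r i))"
    by (simp add: fun_eq_iff vec_eq_iff signed_perm_def reverse_factor_def flip_def)
  then have "image_mset (reverse_factor s i) B = image_mset (signed_perm s \<sigma> (r(i := \<not> r i))) A"
    by (simp add: B image_mset.compositionality)
  then show ?case using \<sigma> by blast
qed

text \<open>One exchange, then one reversal for each factor in the finite set \<open>R\<close> of
  reversed factors, by induction on \<open>R\<close>.\<close>

lemma obtainable_signed_perm:
  fixes s :: "'k::finite \<Rightarrow> nat"
  assumes \<sigma>: "level_perm s \<sigma>"
  shows "obtainable s A (image_mset (signed_perm s \<sigma> r) A)"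
proof -
  have perm: "permute_factors \<sigma> = signed_perm s \<sigma> (\<lambda>_. False)"
    by (simp add: fun_eq_iff vec_eq_iff signed_perm_def permute_factors_def)
  have "obtainable s A (image_mset (signed_perm s \<sigma> (\<lambda>l. l \<in> R)) A)" for R :: "'k set"
  proof (induction R rule: finite_induct[OF finite])
    case 1
    have "permute_factors \<sigma> ` design_space s \<subseteq> design_space s"
      by (auto simp: perm signed_perm_in_design_space_iff[OF \<sigma>])
    then show ?case
      using obtainable.exchange[OF obtainable.refl, of \<sigma> s A] \<sigma> by (simp add: perm level_perm_def)
  next
    case (2 i R)
    have "reverse_factor s i \<circ> signed_perm s \<sigma> (\<lambda>l. l \<in> R) = signed_perm s \<sigma> (\<lambda>l. l \<in> insert i R)"
      using 2 by (auto simp: fun_eq_iff vec_eq_iff signed_perm_def reverse_factor_def flip_def)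
    then show ?case
      using obtainable.reverse[OF 2(3), of i] by (simp add: image_mset.compositionality)
  qed
  from this[of "{l. r l}"] show ?thesis by simp
qed

text \<open>Signed permutations are invertible, so the two directions in the definition of
  isomorphism merge into one. Writing \<open>A\<close> as the image of \<open>B\<close> fits the
  expression of \<open>b\<close> through \<open>b'\<close>.\<close>

lemma geometrically_isomorphic_iff:
  assumes pos: "\<And>i. 0 < s i"
  shows "geometrically_isomorphic s A B \<longleftrightarrow>
    (\<exists>\<sigma> r. level_perm s \<sigma> \<and> A = image_mset (signed_perm s \<sigma> r) B)"
proof
  assume "geometrically_isomorphic s A B"
  then consider "obtainable s A B" | "obtainable s B A"
    by (auto simp: geometrically_isomorphic_def)
  then show "\<exists>\<sigma> r. level_perm s \<sigma> \<and> A = image_mset (signed_perm s \<sigma> r) B"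
  proof cases
    case 1
    then obtain \<sigma> r where \<sigma>: "level_perm s \<sigma>" and B: "B = image_mset (signed_perm s \<sigma> r) A"
      using obtainable_imp_signed_perm[where s = s, OF _ pos] by blast
    have "A = image_mset (signed_perm s (inv \<sigma>) (\<lambda>l. r (inv \<sigma> l))) B"
      by (simp add: B image_mset.compositionality o_def signed_perm_inv1[OF \<sigma>])
    then show ?thesis using level_perm_inv[OF \<sigma>] by blast
  next
    case 2
    then show ?thesis using obtainable_imp_signed_perm[where s = s, OF _ pos] by blast
  qed
next
  assume "\<exists>\<sigma> r. level_perm s \<sigma> \<and> A = image_mset (signed_perm s \<sigma> r) B"
  then show "geometrically_isomorphic s A B"
    using obtainable_signed_perm by (auto simp: geometrically_isomorphic_def)
qed

section \<open>Image designs and their indicator functions\<close>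

text \<open>By surjectivity it suffices to compare multiplicities at points \<open>f x\<close>; by
  injectivity the fibre over such a point is just \<open>x\<close>.\<close>

lemma image_mset_bij_iff:
  assumes "bij f"
  shows "A = image_mset f B \<longleftrightarrow> (\<forall>x. count A (f x) = count B x)"
proof -
  have "A = image_mset f B \<longleftrightarrow> (\<forall>x. count A (f x) = count (image_mset f B) (f x))"
    unfolding multiset_eq_iff using bij_is_surj[OF assms] by (metis surjD)
  moreover have "f -` {f x} = {x}" for x
    using bij_is_inj[OF assms] by (auto dest: injD)
  then have "count (image_mset f B) (f x) = count B x" for x
    by (cases "x \<in># B") (simp_all add: count_image_mset not_in_iff)
  ultimately show ?thesis by simp
qed

text \<open>A signed permutation maps the complement of the design space into itself, and there both
  multiplicities are zero.\<close>

lemma design_image_iff: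
  assumes "is_design s A" "is_design s B" "level_perm s \<sigma>"
  shows "A = image_mset (signed_perm s \<sigma> r) B \<longleftrightarrow>
    (\<forall>x\<in>design_space s. indicator_fun A (signed_perm s \<sigma> r x) = indicator_fun B x)"
proof -
  have "count A (signed_perm s \<sigma> r x) = count B x" if "x \<notin> design_space s" for x
  proof -
    have "signed_perm s \<sigma> r x \<notin># A" "x \<notin># B"
      using that assms signed_perm_in_design_space_iff[OF assms(3), of r x]
      unfolding is_design_def by blast+
    then show ?thesis by (simp add: not_in_iff)
  qed
  then show ?thesis
    unfolding image_mset_bij_iff[OF bij_signed_perm[OF assms(3)]] indicator_fun_def by auto
qed

section \<open>Action on basis functions and coefficients\<close>

text \<open>This is the sign of the theorem with \<open>j l = of_bool (r l)\<close>.\<close>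

definition index_sign :: "('k::finite \<Rightarrow> bool) \<Rightarrow> ('k \<Rightarrow> nat) \<Rightarrow> real" where
  "index_sign r t = (\<Prod>l\<in>UNIV. (-1) ^ (of_bool (r l) * t l))"

lemma index_sign_square: "index_sign r t * (index_sign r t * a) = a"
  by (simp add: index_sign_def flip: mult.assoc prod.distrib power_mult_distrib)

text \<open>Each reversed factor contributes its sign by the reflection symmetry. The conditions of
  an OPB fix each polynomial on the levels only up to sign, so \<open>same_levels\<close> is what
  lets \<open>C (\<sigma> l)\<close> replace \<open>C l\<close>.\<close>

lemma OPB_fun_signed_perm:
  assumes OPB: "is_OPB s C"
    and same_levels: "\<And>i j u x. s i = s j \<Longrightarrow> u < s i \<Longrightarrow> x \<in> levels (s i) \<Longrightarrow> C i u x = C j u x"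
    and \<sigma>: "level_perm s \<sigma>" and t: "t \<in> index_set s" and x: "x \<in> design_space s"
  shows "OPB_fun C t (signed_perm s \<sigma> r x) = index_sign r t * OPB_fun C (\<lambda>l. t (inv \<sigma> l)) x"
proof -
  have p: "\<sigma> permutes UNIV" and s: "\<And>l. s (\<sigma> l) = s l" using \<sigma> by (auto simp: level_perm_def)
  have "C l (t l) (flip (r l) (s l) (x $ \<sigma> l)) =
      (-1) ^ (of_bool (r l) * t l) * C (\<sigma> l) (t l) (x $ \<sigma> l)" for l
  proof -
    have "x $ \<sigma> l \<in> levels (s l)"
      using x s[of l] by (metis (mono_tags) design_space_def mem_Collect_eq)
    moreover have "t l < s l" using t by (simp add: index_set_def)
    ultimately show ?thesis
      using OPB_flip[where i = l, OF OPB] same_levels[of l "\<sigma> l"] s[of l] by simp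
  qed
  then have "OPB_fun C t (signed_perm s \<sigma> r x) =
      index_sign r t * (\<Prod>l\<in>UNIV. C (\<sigma> l) (t l) (x $ \<sigma> l))"
    by (simp add: OPB_fun_def signed_perm_def index_sign_def prod.distrib)
  \<comment> \<open>With \<open>m = \<sigma> l\<close> as the new product variable, factor
    \<open>m\<close> receives the degree \<open>t (inv \<sigma> m)\<close>; points move by
    \<open>\<sigma>\<close>, indices by its inverse.\<close>
  also have "(\<Prod>l\<in>UNIV. C (\<sigma> l) (t l) (x $ \<sigma> l)) = OPB_fun C (\<lambda>l. t (inv \<sigma> l)) x"
    using prod.permute[OF p, of "\<lambda>l. C l (t (inv \<sigma> l)) (x $ l)"]
    by (simp add: OPB_fun_def o_def permutes_inverses[OF p])
  finally show ?thesis .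
qed

lemma bij_betw_signed_perm:
  "level_perm s \<sigma> \<Longrightarrow> bij_betw (signed_perm s \<sigma> r) (design_space s) (design_space s)"
  by (rule bij_betw_byWitness[where f' = "signed_perm s (inv \<sigma>) (\<lambda>l. r (inv \<sigma> l))"])
     (auto simp: signed_perm_inv1 signed_perm_inv2 signed_perm_in_design_space_iff level_perm_inv)

lemma bij_betw_index_set:
  assumes "level_perm s \<sigma>"
  shows "bij_betw (\<lambda>t l. t (inv \<sigma> l)) (index_set s) (index_set s)"
  using assms level_perm_inv[OF assms]
  by (intro bij_betw_byWitness[where f' = "\<lambda>t l. t (\<sigma> l)"])
     (auto simp: level_perm_index_set, auto simp: level_perm_inverses)

text \<open>From functions to coefficients, inner products with the basis are compared after a
  change of variable by the signed permutation. Conversely, the relation is inserted into the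
  expansion of \<open>F\<close> and the index is renamed.\<close>

lemma transformed_iff_coeffs:
  assumes pos: "\<And>i. 0 < s i" and OPB: "is_OPB s C"
    and same_levels: "\<And>i j u x. s i = s j \<Longrightarrow> u < s i \<Longrightarrow> x \<in> levels (s i) \<Longrightarrow> C i u x = C j u x"
    and \<sigma>: "level_perm s \<sigma>"
    and F: "\<And>x. x \<in> design_space s \<Longrightarrow> F x = (\<Sum>t\<in>index_set s. b t * OPB_fun C t x)"
    and G: "\<And>x. x \<in> design_space s \<Longrightarrow> G x = (\<Sum>t\<in>index_set s. b' t * OPB_fun C t x)"
  shows "(\<forall>x\<in>design_space s. F (signed_perm s \<sigma> r x) = G x) \<longleftrightarrow>
    (\<forall>t\<in>index_set s. b t = index_sign r t * b' (\<lambda>l. t (inv \<sigma> l)))"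
proof
  assume eq: "\<forall>x\<in>design_space s. F (signed_perm s \<sigma> r x) = G x"
  show "\<forall>t\<in>index_set s. b t = index_sign r t * b' (\<lambda>l. t (inv \<sigma> l))"
  proof
    fix t assume t: "t \<in> index_set s"
    let ?N = "\<Prod>i\<in>UNIV. real (s i)"
    have "?N * b t = (\<Sum>x\<in>design_space s. F x * OPB_fun C t x)"
      using OPB_coeff[OF OPB t F] by simp
    also have "\<dots> = (\<Sum>x\<in>design_space s.
        F (signed_perm s \<sigma> r x) * OPB_fun C t (signed_perm s \<sigma> r x))"
      by (rule sum.reindex_bij_betw[OF bij_betw_signed_perm[OF \<sigma>], symmetric])
    also have "\<dots> = (\<Sum>x\<in>design_space s. index_sign r t * (G x * OPB_fun C (\<lambda>l. t (inv \<sigma> l)) x))"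
    proof (rule sum.cong[OF HOL.refl])
      fix x assume "x \<in> design_space s"
      with eq OPB_fun_signed_perm[OF OPB same_levels \<sigma> t this, of r]
      show "F (signed_perm s \<sigma> r x) * OPB_fun C t (signed_perm s \<sigma> r x) =
          index_sign r t * (G x * OPB_fun C (\<lambda>l. t (inv \<sigma> l)) x)"
        by simp
    qed
    also have "\<dots> = ?N * (index_sign r t * b' (\<lambda>l. t (inv \<sigma> l)))"
      using OPB_coeff[OF OPB level_perm_index_set[OF level_perm_inv[OF \<sigma>] t] G]
      by (simp flip: sum_distrib_left)
    \<comment> \<open>The factor \<open>?N\<close> is nonzero, since every factor has a level, and
      cancels.\<close>
    finally show "b t = index_sign r t * b' (\<lambda>l. t (inv \<sigma> l))"
      using pos by (simp add: less_imp_neq[symmetric])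
  qed
next
  assume eq: "\<forall>t\<in>index_set s. b t = index_sign r t * b' (\<lambda>l. t (inv \<sigma> l))"
  show "\<forall>x\<in>design_space s. F (signed_perm s \<sigma> r x) = G x"
  proof
    fix x assume x: "x \<in> design_space s"
    have "F (signed_perm s \<sigma> r x) = (\<Sum>t\<in>index_set s. b t * OPB_fun C t (signed_perm s \<sigma> r x))"
      using x by (simp add: F signed_perm_in_design_space_iff[OF \<sigma>])
    also have "\<dots> = (\<Sum>t\<in>index_set s. b' (\<lambda>l. t (inv \<sigma> l)) * OPB_fun C (\<lambda>l. t (inv \<sigma> l)) x)"
    proof (rule sum.cong[OF HOL.refl])
      fix t assume t: "t \<in> index_set s"
      \<comment> \<open>The sign arises twice, from the coefficient and from the basis function, and
        so disappears.\<close>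
      have "b t * OPB_fun C t (signed_perm s \<sigma> r x) = index_sign r t * (index_sign r t *
          (b' (\<lambda>l. t (inv \<sigma> l)) * OPB_fun C (\<lambda>l. t (inv \<sigma> l)) x))"
        using eq t OPB_fun_signed_perm[OF OPB same_levels \<sigma> t x, of r] by simp
      then show "b t * OPB_fun C t (signed_perm s \<sigma> r x) =
          b' (\<lambda>l. t (inv \<sigma> l)) * OPB_fun C (\<lambda>l. t (inv \<sigma> l)) x"
        by (simp only: index_sign_square)
    qed
    also have "\<dots> = (\<Sum>t\<in>index_set s. b' t * OPB_fun C t x)"
      by (rule sum.reindex_bij_betw[OF bij_betw_index_set[OF \<sigma>]])
    also have "\<dots> = G x" using G x by simp
    finally show "F (signed_perm s \<sigma> r x) = G x" .
  qed
qed

theorem theorem3p1: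
  fixes s :: "'k::finite \<Rightarrow> nat"
    and C :: "'k \<Rightarrow> nat \<Rightarrow> real \<Rightarrow> real"
    and A B :: "(real ^ 'k) multiset"
    and b b' :: "('k \<Rightarrow> nat) \<Rightarrow> real"
  assumes levels_pos: "\<And>i. 0 < s i"
    and OPB: "is_OPB s C"
    and same_levels: "\<And>i j u x. s i = s j \<Longrightarrow> u < s i \<Longrightarrow> x \<in> levels (s i) \<Longrightarrow> C i u x = C j u x"
    and designs: "is_design s A" "is_design s B"
    and F_A: "\<And>x. x \<in> design_space s \<Longrightarrow>
      indicator_fun A x = (\<Sum>t\<in>index_set s. b t * OPB_fun C t x)"
    and F_B: "\<And>x. x \<in> design_space s \<Longrightarrow>
      indicator_fun B x = (\<Sum>t\<in>index_set s. b' t * OPB_fun C t x)"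
  shows "geometrically_isomorphic s A B \<longleftrightarrow>
    (\<exists>\<pi> (j :: 'k \<Rightarrow> nat). \<pi> permutes UNIV \<and> (\<forall>l. s (\<pi> l) = s l) \<and> (\<forall>l. j l \<in> {0, 1}) \<and>
      (\<forall>t\<in>index_set s. b t = (\<Prod>l\<in>UNIV. (-1) ^ (j l * t l)) * b' (\<lambda>l. t (\<pi> l))))"
proof -
  have "geometrically_isomorphic s A B \<longleftrightarrow> (\<exists>\<sigma> r. level_perm s \<sigma> \<and>
      (\<forall>t\<in>index_set s. b t = index_sign r t * b' (\<lambda>l. t (inv \<sigma> l))))" (is "_ \<longleftrightarrow> ?signed")
    using design_image_iff[OF designs] transformed_iff_coeffs[OF levels_pos OPB same_levels _ F_A F_B]
    unfolding geometrically_isomorphic_iff[OF levels_pos] by blast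
  \<comment> \<open>Only the parameters change: \<open>\<pi>\<close> is \<open>inv \<sigma>\<close>,
    and \<open>j l\<close> is the truth value \<open>r l\<close> read as a number.\<close>
  also have "?signed \<longleftrightarrow>
    (\<exists>\<pi> (j :: 'k \<Rightarrow> nat). \<pi> permutes UNIV \<and> (\<forall>l. s (\<pi> l) = s l) \<and> (\<forall>l. j l \<in> {0, 1}) \<and>
      (\<forall>t\<in>index_set s. b t = (\<Prod>l\<in>UNIV. (-1) ^ (j l * t l)) * b' (\<lambda>l. t (\<pi> l))))"
    (is "_ \<longleftrightarrow> ?coeffs")
  proof
    assume ?signed
    then obtain \<sigma> r where \<sigma>: "level_perm s \<sigma>"
      and b: "\<forall>t\<in>index_set s. b t = index_sign r t * b' (\<lambda>l. t (inv \<sigma> l))"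
      by blast
    then show ?coeffs
      using level_perm_inv[OF \<sigma>] unfolding level_perm_def index_sign_def
      by (intro exI[of _ "inv \<sigma>"] exI[of _ "\<lambda>l. of_bool (r l)"]) simp
  next
    assume ?coeffs
    then obtain \<pi> and j :: "'k \<Rightarrow> nat" where \<pi>: "level_perm s \<pi>" and j: "\<forall>l. j l \<in> {0, 1}"
      and b: "\<forall>t\<in>index_set s. b t = (\<Prod>l\<in>UNIV. (-1) ^ (j l * t l)) * b' (\<lambda>l. t (\<pi> l))"
      unfolding level_perm_def by blast
    \<comment> \<open>A vector with entries 0 and 1 is recovered from the set of positions where it
      is 1.\<close>
    have "j = (\<lambda>l. of_bool (j l = 1))" using j by (auto simp: fun_eq_iff of_bool_def)
    then have "index_sign (\<lambda>l. j l = 1) t = (\<Prod>l\<in>UNIV. (-1) ^ (j l * t l))" for t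
      unfolding index_sign_def by metis
    moreover have "inv (inv \<pi>) = \<pi>"
      using \<pi> by (rule level_perm_inv_inv)
    ultimately show ?signed
      using b level_perm_inv[OF \<pi>]
      by (intro exI[of _ "inv \<pi>"] exI[of _ "\<lambda>l. j l = 1"]) simp
  qed
  finally show ?thesis .
qed

end
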